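(* Let $P_n$ be a path on $n$ vertices. Then $$\mathcal{S}_{\chi^+}(P_n,x)=\begin{cases}\sum\limits_{i=0}^{\frac{n-1}{2}}\left[(3n-6i-3)x+(3n-6i+1)\right]x^{2i}, & \text{if } n \text{ is odd};\\[2mm] 3\cdot\sum\limits_{i=0}^{n}(n-i)x^i, & \text{if } n \text{ is even}.\end{cases}$$
   Context: All graphs are finite, simple, undirected and connected; $d(u,v)$ is the usual graph distance. Let $\ell=\chi(G)$ be the chromatic number of $G$. All colourings considered are proper vertex colourings with $\ell$ colours $c_1,\dots,c_\ell$; for such a colouring $\varphi$ put $\zeta_\varphi(v)=s$ if $\varphi(v)=c_s$. A $\chi^+$-colouring of $G$ is such a colouring in which $c_\ell$ is assigned to the maximum possible number of vertices, then $c_{\ell-1}$ is assigned to the maximum possible number of the remaining uncoloured vertices, and so on until all vertices are coloured. The $\chi^+$-chromatic Schultz polynomial of $G$ is $$\mathcal{S}_{\chi^+}(G,x)=\sum_{u,v\in V(G)}\bigl(\zeta_{\varphi^+}(u)+\zeta_{\varphi^+}(v)\bigr)x^{d(u,v)},$$ where $\varphi^+$ is a $\chi^+$-colouring of $G$, and the sum runs over unordered pairs $\{u,v\}$ of vertices, each counted once, with the case $u=v$ included (so each vertex $v$ contributes $2\zeta_{\varphi^+}(v)$ to the constant term).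
   Formalization: The formal theorem assumes n ≥ 2: for n = 1 the path has chromatic number 1, so its polynomial is 2, while the printed formula for odd n gives 4. *)

theory Defs
  imports
    "Graph_Theory.Graph_Theory"
    "HOL-Computational_Algebra.Polynomial"
begin

text \<open>
  A finite simple undirected graph is a digraph satisfying the locale \<open>graph\<close> of
  the AFP graph library: finite, loop-free, without parallel arcs, symmetric. Each undirected edge is
  thus a pair of opposite arcs, so the number of arcs of a walk is its usual length.
\<close>

definition graph_dist :: "('a,'b) pre_digraph \<Rightarrow> 'a \<Rightarrow> 'a \<Rightarrow> nat" where
  "graph_dist G u v = (LEAST k. \<exists>p. pre_digraph.awalk G u p v \<and> length p = k)"

definition is_path_graph :: "nat \<Rightarrow> ('a,'b) pre_digraph \<Rightarrow> bool" where
  "is_path_graph n G \<longleftrightarrow> graph G \<and>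
     (\<exists>f. bij_betw f {1..n} (verts G) \<and>
          (\<forall>i\<in>{1..n}. \<forall>j\<in>{1..n}. f i \<rightarrow>\<^bsub>G\<^esub> f j \<longleftrightarrow> j = i + 1 \<or> i = j + 1))"

text \<open>
  The colour $c_s$ is represented by its index $s$, so that a colouring coincides with its
  index function $\zeta$. Values outside the vertex set are irrelevant.
\<close>

definition proper_colouring :: "('a,'b) pre_digraph \<Rightarrow> nat \<Rightarrow> ('a \<Rightarrow> nat) \<Rightarrow> bool" where
  "proper_colouring G k \<phi> \<longleftrightarrow>
     \<phi> ` verts G \<subseteq> {1..k} \<and>
     (\<forall>u\<in>verts G. \<forall>v\<in>verts G. u \<rightarrow>\<^bsub>G\<^esub> v \<longrightarrow> \<phi> u \<noteq> \<phi> v)"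

definition chromatic_number :: "('a,'b) pre_digraph \<Rightarrow> nat" where
  "chromatic_number G = (LEAST k. \<exists>\<phi>. proper_colouring G k \<phi>)"

definition colour_class :: "('a,'b) pre_digraph \<Rightarrow> ('a \<Rightarrow> nat) \<Rightarrow> nat \<Rightarrow> 'a set" where
  "colour_class G \<phi> s = {v \<in> verts G. \<phi> v = s}"

text \<open>
  The greedy choice, from the last colour downwards: once the classes of all colours above \<open>s\<close>
  are fixed, colour \<open>s\<close> is given to as many of the remaining vertices as a proper colouring
  with \<open>chromatic_number G\<close> colours extending these classes allows.
\<close>

definition chi_plus_colouring :: "('a,'b) pre_digraph \<Rightarrow> ('a \<Rightarrow> nat) \<Rightarrow> bool" where
  "chi_plus_colouring G \<phi> \<longleftrightarrow>
     proper_colouring G (chromatic_number G) \<phi> \<and>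
     (\<forall>s\<in>{1..chromatic_number G}. \<forall>\<psi>.
        proper_colouring G (chromatic_number G) \<psi> \<and>
        (\<forall>t\<in>{s<..chromatic_number G}. colour_class G \<psi> t = colour_class G \<phi> t) \<longrightarrow>
        card (colour_class G \<psi> s) \<le> card (colour_class G \<phi> s))"

text \<open>
  Sum of a symmetric function over the unordered pairs $\{u,v\}$ of elements of \<open>V\<close>, each
  counted once, with $u = v$ allowed: for symmetric \<open>f\<close> the description denotes \<open>f u v\<close>.
\<close>

definition sum_unordered_pairs :: "('a \<Rightarrow> 'a \<Rightarrow> 'c::comm_monoid_add) \<Rightarrow> 'a set \<Rightarrow> 'c" where
  "sum_unordered_pairs f V =
     (\<Sum>e\<in>{{u, v} |u v. u \<in> V \<and> v \<in> V}. THE y. \<exists>u v. e = {u, v} \<and> y = f u v)"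

lemma sum_unordered_pairs_term:
  assumes "\<And>u v. f u v = f v u"
  shows "(THE y. \<exists>u' v'. {u, v} = {u', v'} \<and> y = f u' v') = f u v"
  using assms by (intro the_equality) (auto simp: doubleton_eq_iff)

lemma (in sym_digraph) awalk_reverse:
  "awalk u p v \<Longrightarrow> \<exists>q. awalk v q u \<and> length q = length p"
proof (induction p arbitrary: u)
  case Nil
  then show ?case by (intro exI[of _ "[]"]) (auto simp: awalk_Nil_iff)
next
  case (Cons a p)
  from Cons.prems have a: "a \<in> arcs G" "tail G a = u" and p: "awalk (head G a) p v"
    by (auto simp: awalk_Cons_iff)
  from Cons.IH[OF p] obtain q where q: "awalk v q (head G a)" "length q = length p"
    by blast
  have "head G a \<rightarrow> u"
    using arcs_ends_symmetric[OF sym_arcs, of u "head G a"] a dominatesI[of a u "head G a"]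
    by (auto simp: arc_to_ends_def)
  then obtain b where b: "b \<in> arcs G" "tail G b = head G a" "head G b = u"
    by (auto simp: arcs_ends_def arc_to_ends_def)
  have "awalk (head G a) [b] u"
    using b by (auto simp: awalk_Cons_iff awalk_Nil_iff)
  with q(1) have "awalk v (q @ [b]) u"
    by (rule awalk_appendI)
  with q(2) show ?case by (intro exI[of _ "q @ [b]"]) simp
qed

lemma (in sym_digraph) graph_dist_commute: "graph_dist G u v = graph_dist G v u"
proof -
  have "(\<exists>p. awalk u p v \<and> length p = k) \<longleftrightarrow> (\<exists>p. awalk v p u \<and> length p = k)" for k
    using awalk_reverse by metis
  then show ?thesis unfolding graph_dist_def by simp
qed

definition chromatic_schultz_poly :: "('a,'b) pre_digraph \<Rightarrow> ('a \<Rightarrow> nat) \<Rightarrow> int poly" where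
  "chromatic_schultz_poly G \<phi> =
     sum_unordered_pairs (\<lambda>u v. monom (int (\<phi> u) + int (\<phi> v)) (graph_dist G u v)) (verts G)"

end

theory Submission
  imports Defs
begin

text \<open>
  A proper 2-colouring of a path is determined by the colour of an end vertex, so there are only
  two of them. They have equal class sizes when \<open>n\<close> is even; when \<open>n\<close> is odd, the
  \<open>\<chi>\<^sup>+\<close>-condition forces the end vertices to have colour 2. Pairs at odd distance contribute 3
  each, and the pairs at even distance \<open>d\<close> contribute twice the colour sum of the first
  \<open>n - d\<close> vertices.
\<close>

section \<open>Sums over unordered pairs\<close>

lemma sum_unordered_pairs_image:
  fixes f :: "'i::linorder \<Rightarrow> 'a"
  assumes sym: "\<And>u v. g u v = g v u" and inj: "inj_on f I"
  shows "sum_unordered_pairs g (f ` I) = (\<Sum>(i, j)\<in>{(i, j). i \<in> I \<and> j \<in> I \<and> i \<le> j}. g (f i) (f j))"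
proof -
  let ?P = "{(i, j). i \<in> I \<and> j \<in> I \<and> i \<le> j}"
  let ?h = "\<lambda>(i, j). {f i, f j}"
  \<comment> \<open>The order on the indices selects one ordered pair for each doubleton, singletons
    included: if two selected pairs were swaps of each other, both would lie on the
    diagonal.\<close>
  have "inj_on ?h ?P"
    by (intro inj_onI) (auto simp: doubleton_eq_iff inj_on_eq_iff[OF inj])
  moreover have "?h ` ?P = {{u, v} |u v. u \<in> f ` I \<and> v \<in> f ` I}" (is "_ = ?E")
  proof
    show "?E \<subseteq> ?h ` ?P"
    proof
      fix e assume "e \<in> ?E"
      then obtain i j where e: "i \<in> I" "j \<in> I" "e = {f i, f j}" by auto
      show "e \<in> ?h ` ?P"
      proof (cases "i \<le> j")
        case True
        with e show ?thesis by (intro image_eqI[of _ _ "(i, j)"]) auto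
      next
        case False
        with e show ?thesis by (intro image_eqI[of _ _ "(j, i)"]) auto
      qed
    qed
  qed auto
  ultimately have "bij_betw ?h ?P ?E"
    by (simp add: bij_betw_def)
  from sum.reindex_bij_betw[OF this, of "\<lambda>e. THE y. \<exists>u v. e = {u, v} \<and> y = g u v"]
  show ?thesis
    by (simp add: sum_unordered_pairs_def sum_unordered_pairs_term[OF sym] case_prod_unfold)
qed

text \<open>Grouping by the difference \<open>d = j - i\<close> collects the pairs at distance
  \<open>d\<close> once \<open>i\<close> and \<open>j\<close> are positions on a path. The inner sum
  at \<open>d = n\<close> is empty; it lets the outer range match the one in the theorem.\<close>

lemma sum_ordered_pairs_by_difference:
  fixes g :: "nat \<Rightarrow> nat \<Rightarrow> 'c::comm_monoid_add"
  shows "(\<Sum>(i, j)\<in>{(i, j). i \<in> {1..n} \<and> j \<in> {1..n} \<and> i \<le> j}. g i j) =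
    (\<Sum>d=0..n. \<Sum>i=1..n-d. g i (i + d))"
proof -
  have "(\<Sum>d=0..n. \<Sum>i=1..n-d. g i (i + d)) = (\<Sum>(d, i)\<in>Sigma {0..n} (\<lambda>d. {1..n-d}). g i (i + d))"
    by (simp add: sum.Sigma)
  also have "\<dots> = (\<Sum>(i, j)\<in>{(i, j). i \<in> {1..n} \<and> j \<in> {1..n} \<and> i \<le> j}. g i j)"
    by (rule sum.reindex_bij_witness[where i = "\<lambda>(i, j). (j - i, i)" and j = "\<lambda>(d, i). (i, i + d)"])
      auto
  finally show ?thesis ..
qed

lemma sum_monom: "(\<Sum>i\<in>A. monom (c i) d) = monom (\<Sum>i\<in>A. c i) d"
  by (induction A rule: infinite_finite_induct) (auto simp: add_monom)

lemma smult_sum_right: "smult c (\<Sum>i\<in>A. p i) = (\<Sum>i\<in>A. smult c (p i))"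
  by (induction A rule: infinite_finite_induct) (auto simp: smult_add_right)

section \<open>Distances and chromatic number of an indexed path\<close>

locale indexed_path = graph G for G :: "('a, 'b) pre_digraph" +
  fixes n :: nat and f :: "nat \<Rightarrow> 'a"
  assumes two_le: "2 \<le> n"
    and bij: "bij_betw f {1..n} (verts G)"
    and adj: "\<And>i j. i \<in> {1..n} \<Longrightarrow> j \<in> {1..n} \<Longrightarrow> f i \<rightarrow>\<^bsub>G\<^esub> f j \<longleftrightarrow> j = i + 1 \<or> i = j + 1"
begin

lemma verts_eq: "verts G = f ` {1..n}"
  using bij by (simp add: bij_betw_def)

lemma inj: "inj_on f {1..n}"
  using bij by (simp add: bij_betw_def)

lemma f_in_verts: "i \<in> {1..n} \<Longrightarrow> f i \<in> verts G"
  by (auto simp: verts_eq)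

text \<open>Each arc changes the position by exactly one, so \<open>length p\<close> arcs change it
  by at most \<open>length p\<close>. This is the lower bound for the distance.\<close>

lemma awalk_index_bounds:
  assumes "awalk (f i) p (f j)" "i \<in> {1..n}" "j \<in> {1..n}"
  shows "j \<le> i + length p \<and> i \<le> j + length p"
  using assms
proof (induction p arbitrary: i)
  case Nil
  then show ?case using inj by (auto simp: awalk_Nil_iff dest: inj_onD)
next
  case (Cons a p)
  from Cons.prems have a: "a \<in> arcs G" "tail G a = f i" and p: "awalk (head G a) p (f j)"
    by (auto simp: awalk_Cons_iff)
  from a(1) have "head G a \<in> verts G" by auto
  then obtain k where k: "k \<in> {1..n}" "head G a = f k" by (auto simp: verts_eq)
  have "f i \<rightarrow>\<^bsub>G\<^esub> f k" using a k dominatesI[of a "f i" "f k"] by (auto simp: arc_to_ends_def)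
  with adj Cons.prems k(1) have "k = i + 1 \<or> i = k + 1" by auto
  with Cons.IH[of k] p k Cons.prems(3) show ?case by auto
qed

text \<open>Following the path upwards attains the lower bound for the distance.\<close>

lemma awalk_along_path:
  assumes "1 \<le> i" "i + d \<le> n"
  shows "\<exists>p. awalk (f i) p (f (i + d)) \<and> length p = d"
  using assms
proof (induction d arbitrary: i)
  case 0
  then show ?case using f_in_verts by (intro exI[of _ "[]"]) (auto simp: awalk_Nil_iff)
next
  case (Suc d)
  from Suc.IH[of "i + 1"] Suc.prems
  obtain p where p: "awalk (f (i + 1)) p (f (i + 1 + d))" "length p = d" by auto
  from Suc.prems have "f i \<rightarrow>\<^bsub>G\<^esub> f (i + 1)" by (subst adj) auto
  then obtain a where "a \<in> arcs G" "tail G a = f i" "head G a = f (i + 1)"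
    by (auto simp: arcs_ends_def arc_to_ends_def)
  with p show ?case by (intro exI[of _ "a # p"]) (auto simp: awalk_Cons_iff)
qed

lemma graph_dist_eq:
  assumes "1 \<le> i" "i + d \<le> n"
  shows "graph_dist G (f i) (f (i + d)) = d"
  unfolding graph_dist_def
  using awalk_along_path[OF assms] awalk_index_bounds[of i _ "i + d"] assms
  by (intro Least_equality) (auto dest!: awalk_index_bounds)

text \<open>Odd positions get colour 2, so that \<open>f 1\<close> does. This one colouring shows
  2-colourability, is the competitor in the maximality argument, and is the witness for the
  existence of a \<open>\<chi>\<^sup>+\<close>-colouring for \<open>n\<close> of either
  parity.\<close>

definition parity_colouring :: "'a \<Rightarrow> nat" where
  "parity_colouring v = (if odd (the_inv_into {1..n} f v) then 2 else 1)"

lemma parity_colouring_f: "i \<in> {1..n} \<Longrightarrow> parity_colouring (f i) = (if odd i then 2 else 1)"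
  unfolding parity_colouring_def by (subst the_inv_into_f_f[OF inj]) auto

lemma proper_parity_colouring: "proper_colouring G 2 parity_colouring"
  unfolding proper_colouring_def verts_eq
  by (auto simp: parity_colouring_f adj)

lemma chromatic_number_eq: "chromatic_number G = 2"
  unfolding chromatic_number_def
proof (rule Least_equality)
  fix k assume "\<exists>\<phi>. proper_colouring G k \<phi>"
  then obtain \<phi> where \<phi>: "proper_colouring G k \<phi>" ..
  \<comment> \<open>The path has an edge because \<open>2 \<le> n\<close>, and its two ends need
    different colours.\<close>
  have "f 1 \<in> verts G" "f 2 \<in> verts G" "f 1 \<rightarrow>\<^bsub>G\<^esub> f 2"
    using two_le by (auto simp: f_in_verts adj)
  with \<phi> have "\<phi> (f 1) \<in> {1..k}" "\<phi> (f 2) \<in> {1..k}" "\<phi> (f 1) \<noteq> \<phi> (f 2)"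
    by (auto simp: proper_colouring_def)
  then show "2 \<le> k" by auto
qed (use proper_parity_colouring in blast)

section \<open>Class sizes and Schultz polynomial of a proper 2-colouring\<close>

context
  fixes \<phi> assumes proper: "proper_colouring G 2 \<phi>"
begin

lemma colour_range: "i \<in> {1..n} \<Longrightarrow> \<phi> (f i) = 1 \<or> \<phi> (f i) = 2"
proof -
  assume "i \<in> {1..n}"
  then have "\<phi> (f i) \<in> {1..2}"
    using proper f_in_verts[of i] unfolding proper_colouring_def by blast
  then show ?thesis by auto
qed

text \<open>Colours 1 and 2 add up to 3, so a step along the path turns a colour \<open>c\<close>
  into \<open>3 - c\<close>. Working in \<open>int\<close> keeps this subtraction from being
  truncated.\<close>

lemma colour_Suc:
  assumes "1 \<le> i" "i < n"
  shows "int (\<phi> (f (Suc i))) = 3 - int (\<phi> (f i))"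
proof -
  have "f i \<rightarrow>\<^bsub>G\<^esub> f (Suc i)" using assms by (subst adj) auto
  then have "\<phi> (f i) \<noteq> \<phi> (f (Suc i))"
    using proper assms f_in_verts by (auto simp: proper_colouring_def)
  with colour_range[of i] colour_range[of "Suc i"] assms show ?thesis by auto
qed

lemma colour_shift:
  assumes "1 \<le> i" "i + d \<le> n"
  shows "int (\<phi> (f (i + d))) = (if even d then int (\<phi> (f i)) else 3 - int (\<phi> (f i)))"
  using assms
proof (induction d)
  case (Suc d)
  then show ?case using colour_Suc[of "i + d"] by auto
qed simp

text \<open>Consecutive vertices pair up to 3; for odd \<open>m\<close> one vertex is left over, and
  it has the colour of \<open>f 1\<close>. Doubling the sum avoids halving \<open>m\<close>.\<close>

lemma twice_colour_sum:
  assumes "m \<le> n"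
  shows "2 * (\<Sum>i=1..m. int (\<phi> (f i))) = 3 * int m + (if odd m then 2 * int (\<phi> (f 1)) - 3 else 0)"
  using assms
proof (induction m)
  case (Suc m)
  then show ?case using colour_shift[of 1 m] by (auto simp: algebra_simps)
qed simp

text \<open>Each colour is 1 plus the indicator of colour 2, so the colour sum exceeds
  \<open>n\<close> by the size of class 2.\<close>

lemma colour_class_2_card:
  "2 * int (card (colour_class G \<phi> 2)) = int n + (if odd n then 2 * int (\<phi> (f 1)) - 3 else 0)"
proof -
  let ?I = "{i \<in> {1..n}. \<phi> (f i) = 2}"
  have "colour_class G \<phi> 2 = f ` ?I"
    by (auto simp: colour_class_def verts_eq)
  moreover have "inj_on f ?I" by (rule inj_on_subset[OF inj]) auto
  ultimately have card: "card (colour_class G \<phi> 2) = card ?I"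
    by (simp add: card_image)
  have "(\<Sum>i=1..n. int (\<phi> (f i))) = (\<Sum>i=1..n. 1 + (if \<phi> (f i) = 2 then 1 else 0))"
    using colour_range by (intro sum.cong) force+
  also have "\<dots> = int n + int (card ?I)"
    by (simp add: sum.distrib flip: sum.inter_filter)
  finally show ?thesis using twice_colour_sum[of n] card by simp
qed

text \<open>For even \<open>d\<close> the colour sum runs over \<open>n - d\<close> vertices, whose
  number is odd exactly when \<open>n\<close> is; only then does the colour of \<open>f 1\<close>
  enter.\<close>

lemma diagonal_sum:
  assumes "d \<le> n"
  shows "(\<Sum>i=1..n-d. int (\<phi> (f i)) + int (\<phi> (f (i + d)))) =
    3 * (int n - int d) + (if even d \<and> odd n then 2 * int (\<phi> (f 1)) - 3 else 0)"
proof -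
  have "(\<Sum>i=1..n-d. int (\<phi> (f i)) + int (\<phi> (f (i + d)))) =
      (\<Sum>i=1..n-d. if even d then 2 * int (\<phi> (f i)) else 3)"
    using assms by (intro sum.cong refl, subst colour_shift) auto
  also have "\<dots> = (if even d then 2 * (\<Sum>i=1..n-d. int (\<phi> (f i))) else 3 * int (n - d))"
    by (simp add: sum_distrib_left)
  finally show ?thesis
    using twice_colour_sum[of "n - d"] assms by (auto simp: of_nat_diff)
qed

text \<open>The colouring enters only through the colour of \<open>f 1\<close>, and only for odd
  \<open>n\<close>; for even \<open>n\<close> both proper 2-colourings give the same
  polynomial.\<close>

lemma chromatic_schultz_poly_eq:
  "chromatic_schultz_poly G \<phi> = (\<Sum>d=0..n. monom
     (3 * (int n - int d) + (if even d \<and> odd n then 2 * int (\<phi> (f 1)) - 3 else 0)) d)"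
proof -
  let ?g = "\<lambda>u v. monom (int (\<phi> u) + int (\<phi> v)) (graph_dist G u v)"
  have "chromatic_schultz_poly G \<phi> =
      (\<Sum>(i, j)\<in>{(i, j). i \<in> {1..n} \<and> j \<in> {1..n} \<and> i \<le> j}. ?g (f i) (f j))"
    unfolding chromatic_schultz_poly_def verts_eq
    by (rule sum_unordered_pairs_image[OF _ inj]) (simp add: graph_dist_commute add.commute)
  also have "\<dots> = (\<Sum>d=0..n. \<Sum>i=1..n-d. ?g (f i) (f (i + d)))"
    by (rule sum_ordered_pairs_by_difference)
  also have "\<dots> = (\<Sum>d=0..n. \<Sum>i=1..n-d. monom (int (\<phi> (f i)) + int (\<phi> (f (i + d)))) d)"
    by (intro sum.cong refl) (subst graph_dist_eq, auto)
  also have "\<dots> = (\<Sum>d=0..n. monom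
     (3 * (int n - int d) + (if even d \<and> odd n then 2 * int (\<phi> (f 1)) - 3 else 0)) d)"
    using diagonal_sum by (intro sum.cong refl) (simp add: sum_monom)
  finally show ?thesis .
qed

end

section \<open>The \<open>\<chi>\<^sup>+\<close>-colourings of a path and the closed formula\<close>

lemma chi_plus_colouring_iff:
  "chi_plus_colouring G \<phi> \<longleftrightarrow> proper_colouring G 2 \<phi> \<and> (odd n \<longrightarrow> \<phi> (f 1) = 2)"
proof
  assume chi: "chi_plus_colouring G \<phi>"
  then have proper: "proper_colouring G 2 \<phi>"
    by (simp add: chi_plus_colouring_def chromatic_number_eq)
  \<comment> \<open>This is maximality at \<open>s = 2\<close>, where no higher colour has to agree.
    For odd \<open>n\<close> class 2 has \<open>(n + 1) / 2\<close> or \<open>(n - 1) / 2\<close>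
    vertices, according to whether \<open>f 1\<close> has colour 2 or 1.\<close>
  have "card (colour_class G parity_colouring 2) \<le> card (colour_class G \<phi> 2)"
    using chi proper_parity_colouring
    by (auto simp: chi_plus_colouring_def chromatic_number_eq)
  then have "odd n \<Longrightarrow> \<phi> (f 1) = 2"
    using colour_class_2_card[OF proper] colour_class_2_card[OF proper_parity_colouring]
      colour_range[OF proper, of 1] parity_colouring_f[of 1] two_le by auto
  with proper show "proper_colouring G 2 \<phi> \<and> (odd n \<longrightarrow> \<phi> (f 1) = 2)" by blast
next
  assume R: "proper_colouring G 2 \<phi> \<and> (odd n \<longrightarrow> \<phi> (f 1) = 2)"
  have "card (colour_class G \<psi> s) \<le> card (colour_class G \<phi> s)"
    if s: "s \<in> {1..2}" and \<psi>: "proper_colouring G 2 \<psi>"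
      and eq: "\<forall>t\<in>{s<..2}. colour_class G \<psi> t = colour_class G \<phi> t" for s \<psi>
  proof (cases "s = 2")
    case True
    then show ?thesis
      using colour_class_2_card[of \<phi>] colour_class_2_card[OF \<psi>] R colour_range[OF \<psi>, of 1] two_le
      by (auto split: if_splits)
  next
    case False
    with s have "s = 1" by auto
    \<comment> \<open>Once class 2 is fixed, class 1 is the rest of the vertex set, so at
      \<open>s = 1\<close> there is nothing left to maximise.\<close>
    have complement: "colour_class G \<chi> 1 = verts G - colour_class G \<chi> 2"
      if "proper_colouring G 2 \<chi>" for \<chi>
      using colour_range[OF that] unfolding colour_class_def verts_eq by fastforce
    from eq \<open>s = 1\<close> have "colour_class G \<psi> 2 = colour_class G \<phi> 2" by auto
    with complement[OF \<psi>] complement[of \<phi>] R \<open>s = 1\<close> show ?thesis by simp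
  qed
  with R show "chi_plus_colouring G \<phi>"
    by (simp add: chi_plus_colouring_def chromatic_number_eq)
qed

end

lemma is_path_graphE:
  assumes "is_path_graph n G" "2 \<le> n"
  obtains f where "indexed_path G n f"
  using assms unfolding is_path_graph_def indexed_path_def indexed_path_axioms_def by blast

theorem theorem2p4:
  fixes G :: "('a,'b) pre_digraph" and n :: nat
  assumes "n \<ge> 2" and "is_path_graph n G"
  shows "(\<exists>\<phi>. chi_plus_colouring G \<phi>) \<and>
    (\<forall>\<phi>. chi_plus_colouring G \<phi> \<longrightarrow>
       chromatic_schultz_poly G \<phi> =
         (if odd n
          then (\<Sum>i=0..(n - 1) div 2.
                  (monom (3 * int n - 6 * int i - 3) 1 + monom (3 * int n - 6 * int i + 1) 0)
                    * monom 1 (2 * i))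
          else smult 3 (\<Sum>i=0..n. monom (int n - int i) i)))"
proof -
  obtain f where "indexed_path G n f"
    using assms is_path_graphE by blast
  then interpret indexed_path G n f .
  have "chi_plus_colouring G parity_colouring"
    using two_le by (simp add: chi_plus_colouring_iff proper_parity_colouring parity_colouring_f)
  moreover have "chromatic_schultz_poly G \<phi> =
         (if odd n
          then (\<Sum>i=0..(n - 1) div 2.
                  (monom (3 * int n - 6 * int i - 3) 1 + monom (3 * int n - 6 * int i + 1) 0)
                    * monom 1 (2 * i))
          else smult 3 (\<Sum>i=0..n. monom (int n - int i) i))"
    if chi: "chi_plus_colouring G \<phi>" for \<phi>
  proof (cases "odd n")
    case False
    with chi show ?thesis
      by (simp add: chi_plus_colouring_iff chromatic_schultz_poly_eq smult_sum_right smult_monom)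
  next
    case True
    then obtain k where k: "n = 2 * k + 1" by (rule oddE)
    \<comment> \<open>The colour 2 of \<open>f 1\<close> turns the correction
      \<open>2 * int (\<phi> (f 1)) - 3\<close> into 1.\<close>
    define c where "c d = monom (3 * (int n - int d) + (if even d then 1 else 0)) d" for d
    \<comment> \<open>Since \<open>n = 2 * k + 1\<close>, the exponents from 0 to \<open>n\<close>
      split into pairs \<open>2 * i\<close>, \<open>2 * i + 1\<close> with \<open>i \<le> k\<close>.
      The last exponent is \<open>n\<close> itself, with coefficient 0.\<close>
    have pairs: "(\<Sum>d=0..2 * m + 1. c d) = (\<Sum>i=0..m. c (2 * i) + c (2 * i + 1))" for m
      by (induction m) (simp_all add: algebra_simps)
    have "proper_colouring G 2 \<phi>" and "\<phi> (f 1) = 2"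
      using True chi chi_plus_colouring_iff by auto
    then have "chromatic_schultz_poly G \<phi> = (\<Sum>d=0..n. c d)"
      using True unfolding c_def by (subst chromatic_schultz_poly_eq) (auto intro!: sum.cong)
    also have "\<dots> = (\<Sum>i=0..(n - 1) div 2. c (2 * i) + c (2 * i + 1))"
      using pairs[of k] by (simp add: k)
    also have "\<dots> = (\<Sum>i=0..(n - 1) div 2.
        (monom (3 * int n - 6 * int i - 3) 1 + monom (3 * int n - 6 * int i + 1) 0) * monom 1 (2 * i))"
      by (intro sum.cong refl) (simp add: c_def distrib_right mult_monom algebra_simps)
    finally show ?thesis using True by simp
  qed
  ultimately show ?thesis by blast
qed

end
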